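(* Let $n>2$ be an integer, let $c\in(0,1)$, and define (hyperbolic-harmonic case), for $0\le r<1$, $$M_c^n(r)=2\sigma_*(n)(1-r^2)^{n-1}\int_0^{\alpha(c)}\frac{\sin^{n-2}t}{(1-2r\cos t+r^2)^{n-1}}\,dt-1,\qquad M_c^n(1)=1 .$$ Then $$\frac{dM_c^n}{dr}(r)\Big|_{r=1}=\lim_{r\to1^-}\frac{1-M_c^n(r)}{1-r}=0 .$$
   Context: Here $\sigma_*(n)=\frac{1}{\sqrt\pi}\frac{\Gamma(n/2)}{\Gamma((n-1)/2)}$, and $\alpha(c)\in(0,\pi)$ is the spherical angle (angular radius) of a polar cap on the unit sphere $\mathbf{S}^{n-1}\subset\mathbb{R}^n$ of normalized surface measure $c$, i.e. $\sigma_*(n)\int_0^{\alpha(c)}\sin^{n-2}t\,dt=c$. Equivalently, $M_c^n(|x|)=2P[\chi_{S(c,\tilde x)}](x)-1$, where $\tilde x=x/|x|$, $S(c,\tilde x)$ is the polar cap with center $\tilde x$ and normalized measure $c$, and $P[g](x)=\int_{\mathbf{S}^{n-1}}\frac{(1-|x|^2)^{n-1}}{|x-\eta|^{2(n-1)}}g(\eta)\,d\sigma(\eta)$ ($\sigma$ normalized surface measure) is the hyperbolic-harmonic Poisson integral on the unit ball. The derivative at $r=1$ is the left derivative. *)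

theory Defs
  imports "HOL-Analysis.Analysis"
begin

definition sigma_star :: "nat \<Rightarrow> real" where
  "sigma_star n = 1 / sqrt pi * (Gamma (real n / 2) / Gamma ((real n - 1) / 2))"

text \<open>Angular radius of a polar cap of normalized surface measure \<open>c\<close> on the unit sphere of
  \<open>n\<close>-dimensional Euclidean space. The left-hand side of the equation is the normalized measure
  of the cap of angular radius \<open>a\<close>; it increases strictly from 0 to 1 on \<open>[0, \<pi>]\<close>, so
  the angle is well defined for \<open>n \<ge> 2\<close> and \<open>0 < c < 1\<close>.\<close>

definition cap_angle :: "nat \<Rightarrow> real \<Rightarrow> real" where
  "cap_angle n c = (THE a. 0 < a \<and> a < pi \<and>
     sigma_star n * integral {0..a} (\<lambda>t. sin t ^ (n - 2)) = c)"

text \<open>Only the values on \<open>[0, 1]\<close> are meaningful. The value at 1 is set separately because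
  there the integrand is singular at \<open>t = 0\<close>.\<close>

definition hyp_M :: "nat \<Rightarrow> real \<Rightarrow> real \<Rightarrow> real" where
  "hyp_M n c r =
     (if r = 1 then 1
      else 2 * sigma_star n * (1 - r\<^sup>2) ^ (n - 1) *
             integral {0..cap_angle n c}
               (\<lambda>t. sin t ^ (n - 2) / (1 - 2 * r * cos t + r\<^sup>2) ^ (n - 1)) - 1)"

end

theory Submission
  imports Defs
begin

text \<open>The Poisson kernel of the hyperbolic Laplacian is the Jacobian of a Moebius map of the
  sphere. Acting on the polar angle, this map is \<open>u(t) = t + 2 arctan (r sin t / (1 - r cos t))\<close>,
  and it satisfies \<open>u' = (1 - r\<^sup>2) / D\<close> and \<open>sin u = (1 - r\<^sup>2) sin t / D\<close> with
  \<open>D = 1 - 2 r cos t + r\<^sup>2\<close>. Hence the integrand of \<open>M\<close>, together with the factor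
  \<open>(1 - r\<^sup>2)\<^bsup>n-1\<^esup>\<close>, is the derivative of \<open>F \<circ> u\<close> for \<open>F\<close> an antiderivative of
  \<open>sin\<^bsup>n-2\<^esup>\<close>. As \<open>u\<close> maps \<open>[0, \<pi>]\<close> onto itself, \<open>1 - M(r)\<close> is twice the normalized mass of
  the complement of the cap. There \<open>D\<close> is bounded away from 0, so \<open>1 - M(r) = O((1 - r)\<^bsup>n-1\<^esup>)\<close>,
  and \<open>n - 1 \<ge> 2\<close>.\<close>

section \<open>Antiderivatives of powers of the sine\<close>

text \<open>The classical reduction formula for the antiderivative of \<open>sin x ^ k\<close>, as
  integration by parts gives it. The two base cases are normalized to vanish at 0.\<close>

fun sin_power_int :: "nat \<Rightarrow> real \<Rightarrow> real" where
  "sin_power_int 0 x = x"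
| "sin_power_int (Suc 0) x = 1 - cos x"
| "sin_power_int (Suc (Suc k)) x =
     (real (k + 1) * sin_power_int k x - sin x ^ (k + 1) * cos x) / real (k + 2)"

lemma sin_power_int_0 [simp]: "sin_power_int k 0 = 0"
  by (induction k rule: induct_nat_012) auto

lemma DERIV_sin_power_int: "(sin_power_int k has_real_derivative sin x ^ k) (at x)"
proof (induction k rule: induct_nat_012)
  case 0
  have "sin_power_int 0 = (\<lambda>x. x)" by auto
  then show ?case by (auto intro!: derivative_eq_intros)
next
  case 1
  have "sin_power_int (Suc 0) = (\<lambda>x. 1 - cos x)" by auto
  then show ?case by (auto intro!: derivative_eq_intros)
next
  case (ge2 k)
  have eq: "sin_power_int (Suc (Suc k)) =
      (\<lambda>x. (real (k + 1) * sin_power_int k x - sin x ^ (k + 1) * cos x) / real (k + 2))"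
    by auto
  have "(sin_power_int (Suc (Suc k)) has_real_derivative
      (real (k + 1) * sin x ^ k - (real (k + 1) * sin x ^ k * cos x * cos x
        - sin x ^ (k + 1) * sin x)) / real (k + 2)) (at x)"
    unfolding eq by (rule derivative_eq_intros ge2 refl | simp)+
  \<comment> \<open>Replacing the squared cosine by \<open>1 - sin x * sin x\<close> cancels the
    terms in \<open>sin x ^ k\<close>.\<close>
  moreover have "real (k + 1) * sin x ^ k - (real (k + 1) * sin x ^ k * cos x * cos x
        - sin x ^ (k + 1) * sin x) = real (k + 2) * sin x ^ (k + 2)"
  proof -
    have "cos x * cos x = 1 - sin x * sin x"
      using sin_cos_squared_add3[of x] by linarith
    then have "real (k + 1) * sin x ^ k * (cos x * cos x) =
        real (k + 1) * sin x ^ k * (1 - sin x * sin x)"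
      by simp
    then show ?thesis by (simp add: algebra_simps)
  qed
  ultimately show ?case by (simp del: sin_power_int.simps)
qed

lemma integral_sin_power:
  assumes "0 \<le> a"
  shows "integral {0..a} (\<lambda>t. sin t ^ k) = sin_power_int k a"
proof -
  have "((\<lambda>t. sin t ^ k) has_integral sin_power_int k a - sin_power_int k 0) {0..a}"
    using assms DERIV_sin_power_int
    by (intro fundamental_theorem_of_calculus)
       (auto simp flip: has_real_derivative_iff_has_vector_derivative
             intro: has_field_derivative_at_within)
  then show ?thesis by (simp add: integral_unique)
qed

text \<open>The derivative \<open>sin x ^ k\<close> is positive strictly between 0 and pi but may
  vanish at these endpoints, so the criterion on an open interval is used.\<close>

lemma sin_power_int_strict_mono:
  assumes "0 \<le> a" "a < b" "b \<le> pi"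
  shows "sin_power_int k a < sin_power_int k b"
proof (rule DERIV_pos_imp_increasing_open[OF assms(2)])
  show "\<exists>y. (sin_power_int k has_real_derivative y) (at x) \<and> 0 < y" if "a < x" "x < b" for x
    using DERIV_sin_power_int[of k x] sin_gt_zero[of x] that assms
    by (intro exI[of _ "sin x ^ k"]) auto
  show "continuous_on {a..b} (sin_power_int k)"
    using DERIV_sin_power_int by (meson DERIV_continuous_on has_field_derivative_at_within)
qed

section \<open>Total mass, normalization and the cap angle\<close>

lemma Gamma_add_one_pos: "Gamma (x + 1) = x * Gamma x" if "x > 0" for x :: real
  using that nonpos_Ints_nonpos[of x] by (intro Gamma_plus1) auto

text \<open>At pi the boundary term of the reduction formula vanishes, leaving the factor
  (k+1)/(k+2). The functional equation of Gamma gives the same factor on the right.\<close>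

lemma sin_power_int_pi:
  "sin_power_int k pi = sqrt pi * Gamma ((real k + 1) / 2) / Gamma ((real k + 2) / 2)"
proof (induction k rule: induct_nat_012)
  case 0
  show ?case by (simp add: Gamma_one_half_real)
next
  case 1
  have "Gamma (3 / 2 :: real) = sqrt pi / 2"
    using Gamma_add_one_pos[of "1/2"] by (simp add: Gamma_one_half_real)
  moreover have "(real (Suc 0) + 2) / 2 = 3 / 2" "(real (Suc 0) + 1) / 2 = 1" by simp_all
  ultimately show ?case by (simp only:) simp
next
  case (ge2 k)
  have "Gamma ((real (Suc (Suc k)) + 1) / 2) = (real k + 1) / 2 * Gamma ((real k + 1) / 2)"
    using Gamma_add_one_pos[of "(real k + 1) / 2"] by (simp add: field_simps)
  moreover have "Gamma ((real (Suc (Suc k)) + 2) / 2) = (real k + 2) / 2 * Gamma ((real k + 2) / 2)"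
    using Gamma_add_one_pos[of "(real k + 2) / 2"] by (simp add: field_simps)
  moreover have "sin_power_int (Suc (Suc k)) pi = (real k + 1) / (real k + 2) *
      (sqrt pi * Gamma ((real k + 1) / 2) / Gamma ((real k + 2) / 2))"
    using ge2(1) by (simp add: add.commute)
  ultimately show ?case by (simp only:) (simp add: divide_simps)
qed

lemma sigma_star_pos:
  assumes "n > 1"
  shows "sigma_star n > 0"
  using assms by (auto simp: sigma_star_def intro!: divide_pos_pos mult_pos_pos Gamma_real_pos)

lemma sigma_star_sin_power_int_pi:
  assumes "n > 1"
  shows "sigma_star n * sin_power_int (n - 2) pi = 1"
proof -
  have "real (n - 2) = real n - 2" using assms by simp
  moreover have "Gamma (real n / 2) \<noteq> 0" "Gamma ((real n - 1) / 2) \<noteq> 0"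
    using assms Gamma_real_pos[of "real n / 2"] Gamma_real_pos[of "(real n - 1) / 2"] by force+
  ultimately show ?thesis
    by (simp add: sigma_star_def sin_power_int_pi)
qed

text \<open>The defining description is meaningful only after unique existence is shown: the
  normalized mass runs continuously from 0 to 1, and strict monotonicity gives uniqueness.\<close>

lemma cap_angle_bounds:
  assumes "n > 1" "0 < c" "c < 1"
  shows "0 < cap_angle n c \<and> cap_angle n c < pi"
proof -
  define F where "F = sin_power_int (n - 2)"
  have pos: "sigma_star n > 0" using sigma_star_pos assms by simp
  have pi1: "sigma_star n * F pi = 1" unfolding F_def using sigma_star_sin_power_int_pi assms by simp
  have "\<exists>a\<ge>0. a \<le> pi \<and> sigma_star n * F a = c"
  proof (rule IVT)
    show "sigma_star n * F 0 \<le> c" "c \<le> sigma_star n * F pi"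
      using assms pi1 by (auto simp: F_def)
    show "\<forall>x. 0 \<le> x \<and> x \<le> pi \<longrightarrow> isCont (\<lambda>a. sigma_star n * F a) x"
      unfolding F_def by (auto intro!: continuous_intros DERIV_isCont[OF DERIV_sin_power_int])
  qed simp
  then obtain a where a: "0 \<le> a" "a \<le> pi" "sigma_star n * F a = c" by blast
  have "a \<noteq> 0" "a \<noteq> pi" using a assms pi1 by (auto simp: F_def)
  with a have a': "0 < a" "a < pi" by auto
  have "\<exists>!a. 0 < a \<and> a < pi \<and> sigma_star n * integral {0..a} (\<lambda>t. sin t ^ (n - 2)) = c"
  proof (rule ex1I[of _ a])
    show "0 < a \<and> a < pi \<and> sigma_star n * integral {0..a} (\<lambda>t. sin t ^ (n - 2)) = c"
      using a a' by (simp add: integral_sin_power F_def)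
  next
    fix b assume b: "0 < b \<and> b < pi \<and> sigma_star n * integral {0..b} (\<lambda>t. sin t ^ (n - 2)) = c"
    then have "sigma_star n * F b = sigma_star n * F a"
      using a integral_sin_power[of b "n - 2"] by (simp add: F_def)
    then have "F b = F a" using pos by simp
    then show "b = a"
      using sin_power_int_strict_mono[of a b "n - 2"] sin_power_int_strict_mono[of b a "n - 2"] a' b
      unfolding F_def by (cases a b rule: linorder_cases) auto
  qed
  from theI'[OF this] show ?thesis unfolding cap_angle_def by blast
qed

section \<open>The Moebius map on polar angles\<close>

text \<open>For 0 < r < 1 the arctan is minus the argument of 1 - r exp(it), so u =
  \<open>moebius_angle r t\<close> satisfies exp(iu) = (exp(it) - r) / (1 - r exp(it)). This form is
  a smooth real function, without a choice of branch.\<close>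

definition moebius_angle :: "real \<Rightarrow> real \<Rightarrow> real" where
  "moebius_angle r t = t + 2 * arctan (r * sin t / (1 - r * cos t))"

lemma moebius_angle_0 [simp]: "moebius_angle r 0 = 0"
  and moebius_angle_pi [simp]: "moebius_angle r pi = pi"
  by (simp_all add: moebius_angle_def)

context
  fixes r :: real
  assumes r: "0 < r" "r < 1"
begin

lemma one_minus_r_cos_pos: "1 - r * cos t > 0"
  using r mult_left_mono[OF cos_le_one[of t], of r] by linarith

text \<open>Both sides are the squared modulus of 1 - r exp(it).\<close>

lemma sum_squares_eq: "(1 - r * cos t)\<^sup>2 + (r * sin t)\<^sup>2 = 1 - 2 * r * cos t + r\<^sup>2"
proof -
  have "(1 - r * cos t)\<^sup>2 + (r * sin t)\<^sup>2 = 1 - 2 * r * cos t + r\<^sup>2 * ((sin t)\<^sup>2 + (cos t)\<^sup>2)"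
    by algebra
  then show ?thesis by simp
qed

lemma denom_pos: "1 - 2 * r * cos t + r\<^sup>2 > 0"
  using one_minus_r_cos_pos[of t] sum_squares_eq[of t]
  by (metis add_pos_nonneg zero_less_power zero_le_power2)

lemma sin_moebius_angle:
  "sin (moebius_angle r t) = (1 - r\<^sup>2) * sin t / (1 - 2 * r * cos t + r\<^sup>2)"
proof -
  define X where "X = 1 - r * cos t"
  define Y where "Y = r * sin t"
  define D where "D = 1 - 2 * r * cos t + r\<^sup>2"
  have X: "X > 0" and D: "D > 0" and XY: "X\<^sup>2 + Y\<^sup>2 = D"
    using one_minus_r_cos_pos[of t] denom_pos[of t] sum_squares_eq[of t]
    by (auto simp: X_def Y_def D_def)
  \<comment> \<open>\<open>a\<close> is an angle of the right triangle with legs \<open>X\<close>,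
    \<open>Y\<close> and hypotenuse \<open>sqrt D\<close>; its sine and cosine, and then those of
    \<open>2 * a\<close>, are rational up to \<open>sqrt D\<close>.\<close>
  define a where "a = arctan (Y / X)"
  have "1 + (Y / X)\<^sup>2 = D / X\<^sup>2" using X XY by (simp add: field_simps)
  then have sq: "sqrt (1 + (Y / X)\<^sup>2) = sqrt D / X" using X by (simp add: real_sqrt_divide)
  have ca: "cos a = X / sqrt D" and sa: "sin a = Y / sqrt D"
    using X by (simp_all add: a_def cos_arctan sin_arctan sq)
  have s2: "sin (2 * a) = 2 * X * Y / D" and c2: "cos (2 * a) = (X\<^sup>2 - Y\<^sup>2) / D"
    using D by (simp_all add: sin_double cos_double ca sa power_divide diff_divide_distrib)
  have "sin (moebius_angle r t) = sin (t + 2 * a)"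
    by (simp add: moebius_angle_def a_def X_def Y_def)
  also have "\<dots> = (sin t * (X\<^sup>2 - Y\<^sup>2) + cos t * (2 * X * Y)) / D"
    by (simp add: sin_add s2 c2 add_divide_distrib)
  \<comment> \<open>Keeping the sum of squares unexpanded makes this a polynomial identity; the sum
    becomes 1 only afterwards.\<close>
  also have "sin t * (X\<^sup>2 - Y\<^sup>2) + cos t * (2 * X * Y) =
      sin t * (1 - r\<^sup>2 * ((sin t)\<^sup>2 + (cos t)\<^sup>2))"
    unfolding X_def Y_def by algebra
  finally show ?thesis by (simp add: D_def mult.commute)
qed

lemma DERIV_moebius_angle:
  "(moebius_angle r has_real_derivative (1 - r\<^sup>2) / (1 - 2 * r * cos t + r\<^sup>2)) (at t)"
proof -
  define X where "X = 1 - r * cos t"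
  define Y where "Y = r * sin t"
  define D where "D = 1 - 2 * r * cos t + r\<^sup>2"
  have X: "X > 0" and D: "D > 0" and XY: "X\<^sup>2 + Y\<^sup>2 = D"
    using one_minus_r_cos_pos[of t] denom_pos[of t] sum_squares_eq[of t]
    by (auto simp: X_def Y_def D_def)
  have inv: "inverse (1 + (Y / X)\<^sup>2) = X\<^sup>2 / D" using X D XY by (simp add: field_simps)
  have "(moebius_angle r has_real_derivative
      1 + 2 * (inverse (1 + (Y / X)\<^sup>2) * ((r * cos t * X - Y * (r * sin t)) / (X * X)))) (at t)"
    unfolding moebius_angle_def[abs_def] X_def Y_def using X
    by (auto intro!: derivative_eq_intros simp: X_def)
  moreover have "1 + 2 * (inverse (1 + (Y / X)\<^sup>2) * ((r * cos t * X - Y * (r * sin t)) / (X * X)))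
      = (D + 2 * (r * cos t * X - Y * (r * sin t))) / D"
    using X D unfolding inv by (simp add: power2_eq_square field_simps)
  moreover have "D + 2 * (r * cos t * X - Y * (r * sin t)) =
      1 + r\<^sup>2 - 2 * r\<^sup>2 * ((sin t)\<^sup>2 + (cos t)\<^sup>2)"
    unfolding X_def Y_def D_def by algebra
  moreover have "\<dots> = 1 - r\<^sup>2" by simp
  ultimately show ?thesis unfolding D_def by (simp only:)
qed

text \<open>The k-th power of sin u supplies k factors 1/D and u' one more. With k = n - 2 this is
  exactly the exponent n - 1 of the Poisson kernel.\<close>

lemma DERIV_sin_power_int_moebius_angle:
  "((\<lambda>t. sin_power_int k (moebius_angle r t)) has_real_derivative
     (1 - r\<^sup>2) ^ Suc k * (sin t ^ k / (1 - 2 * r * cos t + r\<^sup>2) ^ Suc k)) (at t)"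
  using DERIV_chain2[OF DERIV_sin_power_int DERIV_moebius_angle, of k t]
  by (simp add: sin_moebius_angle power_divide power_mult_distrib mult_ac)

lemma integral_poisson_kernel:
  assumes "0 \<le> a"
  shows "(1 - r\<^sup>2) ^ Suc k * integral {0..a} (\<lambda>t. sin t ^ k / (1 - 2 * r * cos t + r\<^sup>2) ^ Suc k)
    = sin_power_int k (moebius_angle r a)"
proof -
  have "((\<lambda>t. (1 - r\<^sup>2) ^ Suc k * (sin t ^ k / (1 - 2 * r * cos t + r\<^sup>2) ^ Suc k)) has_integral
      sin_power_int k (moebius_angle r a) - sin_power_int k (moebius_angle r 0)) {0..a}"
    using assms DERIV_sin_power_int_moebius_angle
    by (intro fundamental_theorem_of_calculus)
       (auto simp flip: has_real_derivative_iff_has_vector_derivative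
             intro: has_field_derivative_at_within)
  from integral_unique[OF this] show ?thesis by (simp del: power_Suc times_divide_eq_right)
qed

section \<open>Decay of the complementary mass as r tends to 1\<close>

text \<open>The mean value theorem on [a, pi], where the endpoint pi is fixed by the map, reduces
  both bounds to estimating the derivative at one point \<open>z\<close>.\<close>

lemma sin_power_int_complement_bounds:
  assumes a: "0 < a" "a < pi" and "1 / 2 \<le> r"
  shows "0 \<le> sin_power_int k pi - sin_power_int k (moebius_angle r a)"
    and "sin_power_int k pi - sin_power_int k (moebius_angle r a)
      \<le> pi / (1 - cos a) ^ Suc k * (1 - r\<^sup>2) ^ Suc k"
proof -
  let ?D = "\<lambda>t. 1 - 2 * r * cos t + r\<^sup>2"
  obtain z where z: "a < z" "z < pi" and
    eq: "sin_power_int k (moebius_angle r pi) - sin_power_int k (moebius_angle r a) =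
      (pi - a) * ((1 - r\<^sup>2) ^ Suc k * (sin z ^ k / ?D z ^ Suc k))"
    using MVT2[OF a(2) DERIV_sin_power_int_moebius_angle] by metis
  have ca: "1 - cos a > 0" using a cos_monotone_0_pi[of 0 a] by simp
  have "cos z \<le> cos a" using z a by (intro cos_monotone_0_pi_le) auto
  then have "1 - cos a \<le> 1 - cos z" by simp
  \<comment> \<open>Here \<open>1 / 2 \<le> r\<close> enters: it makes the lower bound for the
    denominator independent of r.\<close>
  also have "\<dots> \<le> 2 * r * (1 - cos z)"
    using mult_right_mono[of 1 "2 * r" "1 - cos z"] assms(3) by simp
  also have "\<dots> \<le> 2 * r * (1 - cos z) + (1 - r)\<^sup>2" by simp
  also have "\<dots> = ?D z" by (simp add: power2_eq_square algebra_simps)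
  finally have D: "1 - cos a \<le> ?D z" .
  have r2: "1 - r\<^sup>2 > 0" using r by (simp add: power_less_one_iff)
  have s: "sin z \<ge> 0" "sin z \<le> 1" using z a by (auto intro: sin_ge_zero)
  show "0 \<le> sin_power_int k pi - sin_power_int k (moebius_angle r a)"
    using eq a r2 s denom_pos[of z] by simp
  have "sin z ^ k / ?D z ^ Suc k \<le> 1 / (1 - cos a) ^ Suc k"
    using s ca D by (intro frac_le power_mono zero_less_power) (auto simp: power_le_one)
  then have "(pi - a) * ((1 - r\<^sup>2) ^ Suc k * (sin z ^ k / ?D z ^ Suc k))
      \<le> pi * ((1 - r\<^sup>2) ^ Suc k * (1 / (1 - cos a) ^ Suc k))"
    using a r2 s denom_pos[of z] by (intro mult_mono mult_nonneg_nonneg) auto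
  then show "sin_power_int k pi - sin_power_int k (moebius_angle r a)
      \<le> pi / (1 - cos a) ^ Suc k * (1 - r\<^sup>2) ^ Suc k"
    using eq by simp
qed

text \<open>The constant 2 in 1 - M = 2 - (M + 1) is twice the normalized total mass.\<close>

lemma one_minus_hyp_M:
  assumes "n > 1" "0 < c" "c < 1"
  shows "1 - hyp_M n c r = 2 * sigma_star n *
    (sin_power_int (n - 2) pi - sin_power_int (n - 2) (moebius_angle r (cap_angle n c)))"
proof -
  have n: "Suc (n - 2) = n - 1" using assms by simp
  have "hyp_M n c r =
      2 * sigma_star n * sin_power_int (n - 2) (moebius_angle r (cap_angle n c)) - 1"
    using integral_poisson_kernel[of "cap_angle n c" "n - 2"] cap_angle_bounds[OF assms] r
    unfolding n by (simp add: hyp_M_def mult.assoc)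
  then show ?thesis
    using sigma_star_sin_power_int_pi[OF assms(1)] by (simp add: right_diff_distrib)
qed

end

lemma one_minus_hyp_M_bounds:
  assumes "n > 2" "0 < c" "c < 1"
  obtains K where "\<And>r. 1 / 2 \<le> r \<Longrightarrow> r < 1 \<Longrightarrow> 0 \<le> 1 - hyp_M n c r"
    and "\<And>r. 1 / 2 \<le> r \<Longrightarrow> r < 1 \<Longrightarrow> 1 - hyp_M n c r \<le> K * (1 - r)\<^sup>2"
proof
  define L where "L = 2 * sigma_star n * (pi / (1 - cos (cap_angle n c)) ^ Suc (n - 2))"
  have n: "n > 1" using assms by simp
  have pos: "sigma_star n > 0" using sigma_star_pos n by simp
  note a = cap_angle_bounds[OF n assms(2,3)]
  have L: "L \<ge> 0" unfolding L_def using pos by simp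
  fix r :: real assume r: "1 / 2 \<le> r" "r < 1"
  then have r': "0 < r" by simp
  note b = sin_power_int_complement_bounds[OF r' r(2) conjunct1[OF a] conjunct2[OF a] r(1),
      of "n - 2"]
  note M = one_minus_hyp_M[OF r' r(2) n assms(2,3)]
  show "0 \<le> 1 - hyp_M n c r" unfolding M using b(1) pos by simp
  have "1 - hyp_M n c r \<le> L * (1 - r\<^sup>2) ^ Suc (n - 2)"
    using mult_left_mono[OF b(2), of "2 * sigma_star n"] pos
    unfolding M L_def by (simp add: mult.assoc)
  \<comment> \<open>Since n > 2 the exponent n - 1 is at least 2, and the base lies in
    [0, 1].\<close>
  also have "\<dots> \<le> L * (1 - r\<^sup>2)\<^sup>2"
    using r r' assms L by (intro mult_left_mono power_decreasing) (auto simp: power_le_one)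
  also have "\<dots> \<le> L * (2 * (1 - r))\<^sup>2"
  proof -
    have "1 - r\<^sup>2 = (1 + r) * (1 - r)" by (simp add: power2_eq_square algebra_simps)
    also have "\<dots> \<le> 2 * (1 - r)" using r by (intro mult_right_mono) auto
    finally show ?thesis using L r r'
      by (intro mult_left_mono power_mono) (auto simp: power_le_one)
  qed
  also have "\<dots> = (4 * L) * (1 - r)\<^sup>2" by (simp only: power_mult_distrib) simp
  finally show "1 - hyp_M n c r \<le> (4 * L) * (1 - r)\<^sup>2" .
qed

theorem lemma4p5:
  fixes n :: nat and c :: real
  assumes "n > 2" and "0 < c" and "c < 1"
  shows "(hyp_M n c has_real_derivative 0) (at_left 1) \<and>
         ((\<lambda>r. (1 - hyp_M n c r) / (1 - r)) \<longlongrightarrow> 0) (at_left 1)"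
proof -
  obtain K where K: "\<And>r. 1 / 2 \<le> r \<Longrightarrow> r < 1 \<Longrightarrow> 0 \<le> 1 - hyp_M n c r"
    "\<And>r. 1 / 2 \<le> r \<Longrightarrow> r < 1 \<Longrightarrow> 1 - hyp_M n c r \<le> K * (1 - r)\<^sup>2"
    using one_minus_hyp_M_bounds[OF assms] by blast
  have ev: "eventually (\<lambda>r::real. r \<in> {1 / 2<..<1}) (at_left 1)"
    by (rule eventually_at_left_real) simp
  have lim: "((\<lambda>r. (1 - hyp_M n c r) / (1 - r)) \<longlongrightarrow> 0) (at_left 1)"
  proof (rule tendsto_sandwich)
    show "\<forall>\<^sub>F r in at_left 1. 0 \<le> (1 - hyp_M n c r) / (1 - r)"
      using ev by eventually_elim (use K(1) in auto)
    show "\<forall>\<^sub>F r in at_left 1. (1 - hyp_M n c r) / (1 - r) \<le> K * (1 - r)"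
      using ev
    proof eventually_elim
      case (elim r)
      then show ?case using K(2)[of r] by (simp add: divide_le_eq power2_eq_square mult.assoc)
    qed
    have "((\<lambda>r. K * (1 - r)) \<longlongrightarrow> K * (1 - 1)) (at_left 1)"
      by (intro tendsto_intros)
    then show "((\<lambda>r. K * (1 - r)) \<longlongrightarrow> 0) (at_left 1)" by simp
  qed simp
  \<comment> \<open>As \<open>hyp_M n c 1\<close> is 1 by definition, the difference quotient at 1
    is the quotient just treated, with both signs changed.\<close>
  have "(\<lambda>r. (hyp_M n c r - hyp_M n c 1) / (r - 1)) = (\<lambda>r. (1 - hyp_M n c r) / (1 - r))"
    using minus_divide_divide[of "1 - hyp_M n c r" "1 - r" for r] by (simp add: hyp_M_def)
  with lim show ?thesis by (simp add: has_field_derivative_iff)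
qed

end
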